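(* Let $N=2$. For any two states $\boldsymbol U_l,\boldsymbol U_r$ of the two-component compressible Euler equations with the stiffened equation of state (with $\rho_1>0$, $\rho_2>0$, $T>0$), put $\boldsymbol z=(z_1,\dots,z_6)^{\mathrm T}=(\rho_1,\rho_2,v_1,v_2,v_3,1/T)^{\mathrm T}$ and define $\widetilde{\boldsymbol U}=\widetilde{\boldsymbol U}(\boldsymbol U_l,\boldsymbol U_r)\in\mathbb R^6$ and $\widetilde{\boldsymbol F}_1=\widetilde{\boldsymbol F}_1(\boldsymbol U_l,\boldsymbol U_r)\in\mathbb R^6$ componentwise by $$\widetilde U_\ell=\{z_\ell\}^{\ln}\ (\ell=1,2),\qquad \widetilde U_m=\{z_m\}\sum_{\ell=1}^2\{z_\ell\}^{\ln}\ (m=3,4,5),$$ $$\widetilde U_6=\sum_{\ell=1}^2\Big[\{z_\ell\}^{\ln}\Big(\frac{c_{v,\ell}}{\{z_6\}^{\ln}}-\frac12\sum_{m=3}^5\{z_m^2\}\Big)\Big]+\sum_{\ell=1}^2\{z_\ell\}^{\ln}\sum_{m=3}^5\{z_m\}^2+\sum_{\ell=1}^2p_{\infty,\ell},$$ and $$\widetilde F_{1,\ell}=\{z_\ell\}^{\ln}\{z_3\}\ (\ell=1,2),\qquad \widetilde F_{1,3}=\{z_3\}\sum_{\ell=1}^2\widetilde F_{1,\ell}+\frac{1}{\{z_6\}}\sum_{\ell=1}^2R_\ell\{z_\ell\}-\sum_{\ell=1}^2p_{\infty,\ell},$$ $$\widetilde F_{1,4}=\{z_4\}\sum_{\ell=1}^2\widetilde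 F_{1,\ell},\qquad \widetilde F_{1,5}=\{z_5\}\sum_{\ell=1}^2\widetilde F_{1,\ell},$$ $$\widetilde F_{1,6}=\sum_{\ell=1}^2\Big[\widetilde F_{1,\ell}\Big(\frac{c_{v,\ell}}{\{z_6\}^{\ln}}-\frac12\sum_{m=3}^5\{z_m^2\}\Big)\Big]+\sum_{m=3}^5\{z_m\}\widetilde F_{1,m}+\{z_3\}\sum_{\ell=1}^2p_{\infty,\ell}.$$ Then $\widetilde{\boldsymbol U}$ and $\widetilde{\boldsymbol F}_1$ are symmetric in $(\boldsymbol U_l,\boldsymbol U_r)$, consistent with $\boldsymbol U$ and $\boldsymbol F_1$ respectively (that is, $\widetilde{\boldsymbol U}(\boldsymbol U,\boldsymbol U)=\boldsymbol U$ and $\widetilde{\boldsymbol F}_1(\boldsymbol U,\boldsymbol U)=\boldsymbol F_1(\boldsymbol U)$), and satisfy $$\big(\boldsymbol V(\boldsymbol U_r)-\boldsymbol V(\boldsymbol U_l)\big)^{\mathrm T}\widetilde{\boldsymbol U}=\phi(\boldsymbol U_r)-\phi(\boldsymbol U_l),\qquad \big(\boldsymbol V(\boldsymbol U_r)-\boldsymbol V(\boldsymbol U_l)\big)^{\mathrm T}\widetilde{\boldsymbol F}_1=\psi_1(\boldsymbol U_r)-\psi_1(\boldsymbol U_l).$$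
   Context: The three-dimensional two-component compressible Euler equations are $\partial_t\boldsymbol U+\sum_{k=1}^3\partial_{x_k}\boldsymbol F_k(\boldsymbol U)=0$ with $\boldsymbol U=(\rho_1,\rho_2,\rho v_1,\rho v_2,\rho v_3,E)^{\mathrm T}$ and $\boldsymbol F_k=(\rho_1 v_k,\ \rho_2v_k,\ \rho v_k\boldsymbol v^{\mathrm T}+p\,\boldsymbol e_k^{\mathrm T},\ (E+p)v_k)^{\mathrm T}$, where $\rho_\ell$ is the density of species $\ell$, $\rho=\rho_1+\rho_2$, $\boldsymbol v=(v_1,v_2,v_3)^{\mathrm T}$ the velocity, $\boldsymbol e_k$ the $k$th column of the $3\times3$ identity matrix, and $E=\rho e+\frac12\rho|\boldsymbol v|^2$ the total energy. Stiffened equation of state: $\rho e=\sum_{\ell=1}^2(c_{v,\ell}\rho_\ell T+p_{\infty,\ell})$ and $p=\sum_{\ell=1}^2(\rho_\ell R_\ell T-p_{\infty,\ell})$, where $T$ is the common temperature, $c_{v,\ell}>0$ is the specific heat at constant volume of species $\ell$, $\Gamma_\ell$ its adiabatic index, $R_\ell=c_{v,\ell}(\Gamma_\ell-1)$, and $p_{\infty,\ell}$ a material constant. States are assumed to satisfy $\rho_1,\rho_2,T>0$. Thermodynamic entropies: $S_\ell=c_{v,\ell}\ln T-R_\ell\ln\rho_\ell$; mixture entropy $\rho S=\sum_{\ell=1}^2\rho_\ell S_\ell$. Entropy pair: $\eta(\boldsymbol U)=-\rho S$, $q_k(\boldsymbol U)=\eta v_k$. Entropy variables: $$\boldsymbol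 V=\eta'(\boldsymbol U)^{\mathrm T}=\Big(-S_1-\frac{|\boldsymbol v|^2}{2T}+c_{v,1}\Gamma_1,\ -S_2-\frac{|\boldsymbol v|^2}{2T}+c_{v,2}\Gamma_2,\ \frac{\boldsymbol v^{\mathrm T}}{T},\ -\frac1T\Big)^{\mathrm T}.$$ Entropy potential and entropy potential fluxes: $\phi=\boldsymbol V^{\mathrm T}\boldsymbol U-\eta=\sum_{\ell=1}^2(R_\ell\rho_\ell-p_{\infty,\ell}/T)$ and $\psi_k=\boldsymbol V^{\mathrm T}\boldsymbol F_k-q_k=\phi v_k$. For a quantity $a$ with values $a_l,a_r$ at the left and right states: $\{a\}=\frac12(a_l+a_r)$ is the arithmetic mean (so $\{z_m^2\}=\frac12((z_m)_l^2+(z_m)_r^2)$), and for $a>0$, $\{a\}^{\ln}=(a_r-a_l)/(\ln a_r-\ln a_l)$ is the logarithmic mean, interpreted as $a_l$ when $a_l=a_r$. *)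

theory Defs
  imports "HOL-Analysis.Analysis"
begin

section \<open>Material parameters and conserved states\<close>

text \<open>The two species are indexed by the two-element type \<^typ>\<open>2\<close>. No condition is built into
  the record; positivity of the specific heats is a hypothesis wherever it is needed.\<close>

record material =
  cv :: "2 \<Rightarrow> real"
  Gam :: "2 \<Rightarrow> real"
  pinf :: "2 \<Rightarrow> real"

definition gas_const :: "material \<Rightarrow> 2 \<Rightarrow> real" where
  "gas_const P l = cv P l * (Gam P l - 1)"

text \<open>A state is the vector of conserved variables
  \<open>U = (rho_1, rho_2, rho v_1, rho v_2, rho v_3, E)\<close>.
  Note that \<open>6 = 0\<close> in the index type \<^typ>\<open>6\<close>, which has exactly the elements \<open>1, ..., 6\<close>;
  similarly \<open>2 = 0\<close> in \<^typ>\<open>2\<close> and \<open>3 = 0\<close> in \<^typ>\<open>3\<close>.\<close>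

type_synonym state = "real^6"

definition sp :: "2 \<Rightarrow> 6" where
  "sp l = (if l = 1 then 1 else 2)"

definition total_density :: "state \<Rightarrow> real" where
  "total_density U = (\<Sum>l\<in>UNIV. U $ sp l)"

definition velocity :: "state \<Rightarrow> real^3" where
  "velocity U = (1 / total_density U) *\<^sub>R vector [U $ 3, U $ 4, U $ 5]"

text \<open>\<open>rho e = E - rho |v|^2 / 2\<close>\<close>

definition internal_energy :: "state \<Rightarrow> real" where
  "internal_energy U = U $ 6 - total_density U * (norm (velocity U))\<^sup>2 / 2"

text \<open>The equation of state \<open>rho e = sum_l (c_l rho_l T + pinf_l)\<close>, solved for \<open>T\<close>; see
  \<open>temperature_eq_iff\<close> below.\<close>

definition temperature :: "material \<Rightarrow> state \<Rightarrow> real" where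
  "temperature P U =
     (internal_energy U - (\<Sum>l\<in>UNIV. pinf P l)) / (\<Sum>l\<in>UNIV. cv P l * U $ sp l)"

definition pressure :: "material \<Rightarrow> state \<Rightarrow> real" where
  "pressure P U = (\<Sum>l\<in>UNIV. U $ sp l * gas_const P l * temperature P U - pinf P l)"

definition states :: "material \<Rightarrow> state set" where
  "states P = {U. U $ 1 > 0 \<and> U $ 2 > 0 \<and> temperature P U > 0}"

definition flux :: "material \<Rightarrow> 3 \<Rightarrow> state \<Rightarrow> real^6" where
  "flux P k U =
     (let v = velocity U;
          m = (total_density U * v $ k) *\<^sub>R v + pressure P U *\<^sub>R axis k 1
      in vector [U $ 1 * v $ k, U $ 2 * v $ k, m $ 1, m $ 2, m $ 3,
                 (U $ 6 + pressure P U) * v $ k])"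


section \<open>Entropy structure\<close>

definition species_entropy :: "material \<Rightarrow> 2 \<Rightarrow> state \<Rightarrow> real" where
  "species_entropy P l U = cv P l * ln (temperature P U) - gas_const P l * ln (U $ sp l)"

definition entropy :: "material \<Rightarrow> state \<Rightarrow> real" where
  "entropy P U = - (\<Sum>l\<in>UNIV. U $ sp l * species_entropy P l U)"

definition entropy_flux :: "material \<Rightarrow> 3 \<Rightarrow> state \<Rightarrow> real" where
  "entropy_flux P k U = entropy P U * velocity U $ k"

text \<open>The entropy variables are the gradient of the entropy with respect to the conserved
  variables; \<open>entropy_vars_explicit\<close> below gives the closed form on admissible states.\<close>

definition entropy_vars :: "material \<Rightarrow> state \<Rightarrow> real^6" where
  "entropy_vars P U = (\<chi> i. frechet_derivative (entropy P) (at U) (axis i 1))"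

definition entropy_potential :: "material \<Rightarrow> state \<Rightarrow> real" where
  "entropy_potential P U = entropy_vars P U \<bullet> U - entropy P U"

definition entropy_potential_flux :: "material \<Rightarrow> 3 \<Rightarrow> state \<Rightarrow> real" where
  "entropy_potential_flux P k U = entropy_vars P U \<bullet> flux P k U - entropy_flux P k U"


section \<open>Two-point averages and numerical fluxes\<close>

definition mean :: "real \<Rightarrow> real \<Rightarrow> real" where
  "mean a b = (a + b) / 2"

definition log_mean :: "real \<Rightarrow> real \<Rightarrow> real" where
  "log_mean a b = (if a = b then a else (b - a) / (ln b - ln a))"

definition z_vars :: "material \<Rightarrow> state \<Rightarrow> real^6" where
  "z_vars P U = vector [U $ 1, U $ 2, velocity U $ 1, velocity U $ 2, velocity U $ 3,
                        1 / temperature P U]"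

definition U_tilde :: "material \<Rightarrow> state \<Rightarrow> state \<Rightarrow> real^6" where
  "U_tilde P Ul Ur =
     (let zl = z_vars P Ul; zr = z_vars P Ur;
          avg = (\<lambda>i. mean (zl $ i) (zr $ i));
          avg_sq = (\<lambda>i. mean ((zl $ i)\<^sup>2) ((zr $ i)\<^sup>2));
          lnm = (\<lambda>i. log_mean (zl $ i) (zr $ i));
          r = (\<Sum>l\<in>UNIV. lnm (sp l))
      in vector
          [lnm 1, lnm 2, avg 3 * r, avg 4 * r, avg 5 * r,
           (\<Sum>l\<in>UNIV. lnm (sp l) * (cv P l / lnm 6 - (\<Sum>m\<in>{3,4,5}. avg_sq m) / 2))
             + r * (\<Sum>m\<in>{3,4,5}. (avg m)\<^sup>2)
             + (\<Sum>l\<in>UNIV. pinf P l)])"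

definition F1_tilde :: "material \<Rightarrow> state \<Rightarrow> state \<Rightarrow> real^6" where
  "F1_tilde P Ul Ur =
     (let zl = z_vars P Ul; zr = z_vars P Ur;
          avg = (\<lambda>i. mean (zl $ i) (zr $ i));
          avg_sq = (\<lambda>i. mean ((zl $ i)\<^sup>2) ((zr $ i)\<^sup>2));
          lnm = (\<lambda>i. log_mean (zl $ i) (zr $ i));
          f = (\<lambda>l. lnm (sp l) * avg 3);
          f3 = avg 3 * (\<Sum>l\<in>UNIV. f l)
                 + (1 / avg 6) * (\<Sum>l\<in>UNIV. gas_const P l * avg (sp l))
                 - (\<Sum>l\<in>UNIV. pinf P l);
          f4 = avg 4 * (\<Sum>l\<in>UNIV. f l);
          f5 = avg 5 * (\<Sum>l\<in>UNIV. f l)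
      in vector
          [f 1, f 2, f3, f4, f5,
           (\<Sum>l\<in>UNIV. f l * (cv P l / lnm 6 - (\<Sum>m\<in>{3,4,5}. avg_sq m) / 2))
             + (avg 3 * f3 + avg 4 * f4 + avg 5 * f5)
             + avg 3 * (\<Sum>l\<in>UNIV. pinf P l)])"


section \<open>Consistency of the definitions with the equation of state\<close>

lemma UNIV_6: "UNIV = {1, 2, 3, 4, 5, 6::6}"
proof -
  have "x = 1 \<or> x = 2 \<or> x = 3 \<or> x = 4 \<or> x = 5 \<or> x = 6" for x :: 6
  proof (induct x)
    case (of_int z)
    then have "z = 0 \<or> z = 1 \<or> z = 2 \<or> z = 3 \<or> z = 4 \<or> z = 5" by fastforce
    then show ?case by auto
  qed
  then show ?thesis by auto
qed

lemma sum_6: "sum f (UNIV::6 set) = f 1 + f 2 + f 3 + f 4 + f 5 + f 6"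
  unfolding UNIV_6 by (simp add: ac_simps)

lemma forall_6: "(\<forall>i::6. Q i) \<longleftrightarrow> Q 1 \<and> Q 2 \<and> Q 3 \<and> Q 4 \<and> Q 5 \<and> Q 6"
proof -
  have "(\<forall>i. Q i) \<longleftrightarrow> (\<forall>i\<in>UNIV. Q i)" by simp
  then show ?thesis unfolding UNIV_6 by simp
qed

lemma vector_6 [simp]:
  "(vector [a, b, c, d, e, f] :: ('a::zero)^6) $ 1 = a"
  "(vector [a, b, c, d, e, f] :: ('a::zero)^6) $ 2 = b"
  "(vector [a, b, c, d, e, f] :: ('a::zero)^6) $ 3 = c"
  "(vector [a, b, c, d, e, f] :: ('a::zero)^6) $ 4 = d"
  "(vector [a, b, c, d, e, f] :: ('a::zero)^6) $ 5 = e"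
  "(vector [a, b, c, d, e, f] :: ('a::zero)^6) $ 6 = f"
  unfolding vector_def by auto

lemma sp_simps [simp]: "sp 1 = 1" "sp 2 = 2"
  by (auto simp: sp_def)

lemma temperature_eq_iff:
  assumes "\<And>l. cv P l > 0" "U $ 1 > 0" "U $ 2 > 0"
  shows "temperature P U = T \<longleftrightarrow>
           internal_energy U = (\<Sum>l\<in>UNIV. cv P l * U $ sp l * T + pinf P l)"
proof -
  have "cv P 1 * U $ 1 + cv P 2 * U $ 2 > 0"
    using assms by (simp add: add_pos_pos)
  then show ?thesis
    by (auto simp: temperature_def sum_2 field_simps)
qed

lemma norm_velocity_sq:
  "(norm (velocity U))\<^sup>2 = ((U $ 3)\<^sup>2 + (U $ 4)\<^sup>2 + (U $ 5)\<^sup>2) / (U $ 1 + U $ 2)\<^sup>2"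
proof -
  have "(norm x)\<^sup>2 = (x $ 1)\<^sup>2 + (x $ 2)\<^sup>2 + (x $ 3)\<^sup>2" for x :: "real^3"
    unfolding power2_norm_eq_inner by (simp add: inner_vec_def sum_3 power2_eq_square)
  then show ?thesis
    by (simp add: velocity_def total_density_def sum_2 power_divide add_divide_distrib)
qed

lemma temperature_eq:
  "temperature P U = (U $ 6 - ((U $ 3)\<^sup>2 + (U $ 4)\<^sup>2 + (U $ 5)\<^sup>2) / (2 * (U $ 1 + U $ 2))
      - (pinf P 1 + pinf P 2)) / (cv P 1 * U $ 1 + cv P 2 * U $ 2)"
  unfolding temperature_def internal_energy_def norm_velocity_sq total_density_def sum_2 sp_simps
  by (cases "U $ 1 + U $ 2 = 0") (simp_all add: power2_eq_square)

lemma temperature_has_derivative: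
  assumes cv: "\<And>l. cv P l > 0" and U: "U $ 1 > 0" "U $ 2 > 0"
  defines "v \<equiv> velocity U"
  shows "(temperature P has_derivative
      (\<lambda>h. (h $ 6 - (v $ 1 * h $ 3 + v $ 2 * h $ 4 + v $ 3 * h $ 5)
             + (norm v)\<^sup>2 / 2 * (h $ 1 + h $ 2)
             - temperature P U * (cv P 1 * h $ 1 + cv P 2 * h $ 2))
           / (cv P 1 * U $ 1 + cv P 2 * U $ 2))) (at U)"
proof -
  define R where "R = U $ 1 + U $ 2"
  define C where "C = cv P 1 * U $ 1 + cv P 2 * U $ 2"
  define Q where "Q = (U $ 3)\<^sup>2 + (U $ 4)\<^sup>2 + (U $ 5)\<^sup>2"
  define N where "N = U $ 6 - Q / (2 * R) - (pinf P 1 + pinf P 2)"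
  have C: "C > 0" and R: "R > 0"
    using cv[of 1] cv[of 2] U by (simp_all add: C_def R_def add_pos_pos)
  have T: "temperature P U = N / C"
    by (simp add: temperature_eq N_def C_def Q_def R_def)
  have v: "v $ 1 = U $ 3 / R" "v $ 2 = U $ 4 / R" "v $ 3 = U $ 5 / R" "(norm v)\<^sup>2 = Q / R\<^sup>2"
    unfolding v_def norm_velocity_sq
    by (simp_all add: velocity_def total_density_def sum_2 R_def Q_def)
  have n: "((\<lambda>X::state. X $ i) has_derivative (\<lambda>h. h $ i)) (at U)" for i
    by (intro bounded_linear_imp_has_derivative bounded_linear_vec_nth)
  have dR: "((\<lambda>X::state. X $ 1 + X $ 2) has_derivative (\<lambda>h. h $ 1 + h $ 2)) (at U)"
    by (auto intro!: derivative_eq_intros n)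
  have dC: "((\<lambda>X::state. cv P 1 * X $ 1 + cv P 2 * X $ 2) has_derivative
      (\<lambda>h. cv P 1 * h $ 1 + cv P 2 * h $ 2)) (at U)"
    by (auto intro!: derivative_eq_intros n)
  have dQ: "((\<lambda>X::state. (X $ 3)\<^sup>2 + (X $ 4)\<^sup>2 + (X $ 5)\<^sup>2) has_derivative
      (\<lambda>h. 2 * (U $ 3 * h $ 3 + U $ 4 * h $ 4 + U $ 5 * h $ 5))) (at U)"
    by (auto intro!: derivative_eq_intros n)
  have dN: "((\<lambda>X::state. X $ 6 - ((X $ 3)\<^sup>2 + (X $ 4)\<^sup>2 + (X $ 5)\<^sup>2) / (2 * (X $ 1 + X $ 2))
      - (pinf P 1 + pinf P 2)) has_derivative
      (\<lambda>h. h $ 6 - (U $ 3 * h $ 3 + U $ 4 * h $ 4 + U $ 5 * h $ 5) / R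
            + Q / (2 * R\<^sup>2) * (h $ 1 + h $ 2))) (at U)"
    by (rule has_derivative_eq_rhs,
        rule has_derivative_diff[OF has_derivative_diff[OF n
          has_derivative_divide'[OF dQ has_derivative_mult_right[OF dR]]] has_derivative_const])
      (unfold R_def[symmetric] Q_def[symmetric],
       use R in \<open>auto simp: fun_eq_iff field_simps power2_eq_square\<close>)
  show ?thesis
    unfolding temperature_eq[abs_def]
    by (rule has_derivative_eq_rhs, rule has_derivative_divide'[OF dN dC])
      (unfold C_def[symmetric] R_def[symmetric] Q_def[symmetric] N_def[symmetric] v,
       use R C in \<open>auto simp: T temperature_eq[symmetric] fun_eq_iff field_simps power2_eq_square\<close>)
qed

lemma entropy_has_derivative:
  assumes cv: "\<And>l. cv P l > 0" and U: "U \<in> states P"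
  defines "V \<equiv> vector
      [- species_entropy P 1 U - (norm (velocity U))\<^sup>2 / (2 * temperature P U) + cv P 1 * Gam P 1,
       - species_entropy P 2 U - (norm (velocity U))\<^sup>2 / (2 * temperature P U) + cv P 2 * Gam P 2,
       velocity U $ 1 / temperature P U, velocity U $ 2 / temperature P U,
       velocity U $ 3 / temperature P U, - 1 / temperature P U] :: real^6"
  shows "(entropy P has_derivative (\<lambda>h. V \<bullet> h)) (at U)"
proof -
  have pos: "U $ 1 > 0" "U $ 2 > 0" "temperature P U > 0"
    using U by (auto simp: states_def)
  define T where "T = temperature P U"
  define C where "C = cv P 1 * U $ 1 + cv P 2 * U $ 2"
  have C: "C > 0" and T: "T > 0"
    using cv[of 1] cv[of 2] pos by (simp_all add: C_def T_def add_pos_pos)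
  define dT where "dT = (\<lambda>h::state. (h $ 6
             - (velocity U $ 1 * h $ 3 + velocity U $ 2 * h $ 4 + velocity U $ 3 * h $ 5)
             + (norm (velocity U))\<^sup>2 / 2 * (h $ 1 + h $ 2)
             - T * (cv P 1 * h $ 1 + cv P 2 * h $ 2)) / C)"
  have d: "(temperature P has_derivative dT) (at U)"
    unfolding dT_def C_def T_def using temperature_has_derivative[OF cv pos(1,2)] .
  have n: "((\<lambda>X::state. X $ i) has_derivative (\<lambda>h. h $ i)) (at U)" for i
    by (intro bounded_linear_imp_has_derivative bounded_linear_vec_nth)
  have lnT: "((\<lambda>X. ln (temperature P X)) has_derivative (\<lambda>h. dT h / T)) (at U)"
    by (rule has_derivative_eq_rhs[OF has_derivative_ln[OF pos(3) d]]) (simp add: T_def divide_inverse mult.commute)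
  have lnr: "((\<lambda>X::state. ln (X $ i)) has_derivative (\<lambda>h. h $ i / U $ i)) (at U)" if "U $ i > 0" for i
    by (rule has_derivative_eq_rhs[OF has_derivative_ln[OF that n]]) (simp add: divide_inverse mult.commute)
  have dS: "((\<lambda>X. X $ sp l * species_entropy P l X) has_derivative
      (\<lambda>h. h $ sp l * species_entropy P l U + U $ sp l * cv P l * dT h / T
             - gas_const P l * h $ sp l)) (at U)" if "U $ sp l > 0" for l
    unfolding species_entropy_def
    by (rule has_derivative_eq_rhs,
        rule has_derivative_mult[OF n has_derivative_diff[OF
          has_derivative_mult_right[OF lnT] has_derivative_mult_right[OF lnr[OF that]]]])
      (use that T in \<open>auto simp: fun_eq_iff field_simps\<close>)
  have "(entropy P has_derivative (\<lambda>h. - (\<Sum>l\<in>UNIV. h $ sp l * species_entropy P l U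
        + U $ sp l * cv P l * dT h / T - gas_const P l * h $ sp l))) (at U)"
    unfolding entropy_def[abs_def]
    by (intro has_derivative_minus has_derivative_sum dS) (use pos in \<open>auto simp: sp_def\<close>)
  moreover have "- (\<Sum>l\<in>UNIV. h $ sp l * species_entropy P l U
        + U $ sp l * cv P l * dT h / T - gas_const P l * h $ sp l) = V \<bullet> h" for h
  proof -
    have "(\<Sum>l\<in>UNIV. h $ sp l * species_entropy P l U
        + U $ sp l * cv P l * dT h / T - gas_const P l * h $ sp l)
      = h $ 1 * species_entropy P 1 U + h $ 2 * species_entropy P 2 U + C * dT h / T
        - gas_const P 1 * h $ 1 - gas_const P 2 * h $ 2"
      by (simp add: sum_2 C_def add_divide_distrib algebra_simps)
    also have "C * dT h = h $ 6
             - (velocity U $ 1 * h $ 3 + velocity U $ 2 * h $ 4 + velocity U $ 3 * h $ 5)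
             + (norm (velocity U))\<^sup>2 / 2 * (h $ 1 + h $ 2)
             - T * (cv P 1 * h $ 1 + cv P 2 * h $ 2)"
      using C by (simp add: dT_def)
    finally show ?thesis
      using T by (simp add: V_def inner_vec_def sum_6 T_def[symmetric] gas_const_def)
        (simp add: field_simps)
  qed
  ultimately show ?thesis by simp
qed

lemma entropy_vars_explicit:
  assumes "\<And>l. cv P l > 0" "U \<in> states P"
  shows "entropy_vars P U = vector
      [- species_entropy P 1 U - (norm (velocity U))\<^sup>2 / (2 * temperature P U) + cv P 1 * Gam P 1,
       - species_entropy P 2 U - (norm (velocity U))\<^sup>2 / (2 * temperature P U) + cv P 2 * Gam P 2,
       velocity U $ 1 / temperature P U, velocity U $ 2 / temperature P U,
       velocity U $ 3 / temperature P U, - 1 / temperature P U]"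
  unfolding entropy_vars_def
  by (simp add: frechet_derivative_at[OF entropy_has_derivative[OF assms], symmetric]
      inner_axis vec_eq_iff)

end

theory Submission
  imports Defs
begin

text \<open>
  Write \<open>[a] = a\<^sub>r - a\<^sub>l\<close> for the jump of a quantity between the two states. Two rules
  turn jumps of nonlinear expressions into linear combinations of jumps of the variables \<open>z\<close>:
  the Leibniz rule \<open>[a b] = {a}[b] + {b}[a]\<close>, which gives in particular \<open>[a\<^sup>2] = 2{a}[a]\<close>, and
  \<open>{a}\<^sup>l\<^sup>n [ln a] = [a]\<close>, which defines the logarithmic mean. In the variables \<open>z\<close> the entropy
  variables are
  \<open>V\<^sub>l = R\<^sub>l ln z\<^sub>l + c\<^sub>l ln z\<^sub>6 - z\<^sub>6 |v|\<^sup>2 / 2 + const\<close>, \<open>z\<^sub>6 v\<close> and \<open>- z\<^sub>6\<close>, so \<open>[V]\<close> is a combination of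
  \<open>[ln z\<^sub>l]\<close>, \<open>[v]\<close> and \<open>[z\<^sub>6]\<close>.

  Both two-point functions have the same energy component in terms of the remaining ones: with
  species components \<open>w\<^sub>l\<close> and momentum components \<open>m\<close>, it is
  \<open>\<Sum>\<^sub>l w\<^sub>l (c\<^sub>l / {z\<^sub>6}\<^sup>l\<^sup>n - {|v|\<^sup>2} / 2) + {v} \<bullet> m + \<pi>\<close>. Precisely this choice cancels every
  contribution of \<open>[z\<^sub>6]\<close> except \<open>- \<pi> [z\<^sub>6]\<close>, and leaves (lemma \<open>entropy_vars_jump_inner\<close>)
  \<open>[V] \<bullet> W = \<Sum>\<^sub>l R\<^sub>l w\<^sub>l [ln z\<^sub>l] + {z\<^sub>6} [v] \<bullet> (m - (w\<^sub>1 + w\<^sub>2){v}) - \<pi> [z\<^sub>6]\<close>.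

  For the density function \<open>w\<^sub>l = {z\<^sub>l}\<^sup>l\<^sup>n\<close>, the momentum defect \<open>m - (w\<^sub>1 + w\<^sub>2){v}\<close> vanishes and
  \<open>\<pi>\<close> is \<open>p = \<Sum>\<^sub>l p\<^sub>\<infinity>\<^sub>,\<^sub>l\<close>, so the right-hand side is
  \<open>\<Sum>\<^sub>l R\<^sub>l [z\<^sub>l] - p [z\<^sub>6] = [\<phi>]\<close>. For the flux, \<open>w\<^sub>l\<close> and \<open>\<pi>\<close> carry a factor \<open>{v\<^sub>1}\<close> and the
  defect is the averaged pressure \<open>\<Sum>\<^sub>l R\<^sub>l {z\<^sub>l} / {z\<^sub>6} - p\<close> in the first direction; the right-hand
  side becomes
  \<open>\<Sum>\<^sub>l R\<^sub>l ({v\<^sub>1}[z\<^sub>l] + {z\<^sub>l}[v\<^sub>1]) - p ({z\<^sub>6}[v\<^sub>1] + {v\<^sub>1}[z\<^sub>6]) = [\<phi> v\<^sub>1]\<close> by the Leibniz rule.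
\<close>

section \<open>Arithmetic and logarithmic means\<close>

lemma mean_self [simp]: "mean a a = a"
  by (simp add: mean_def)

lemma mean_commute: "mean a b = mean b a"
  by (simp add: mean_def)

lemma log_mean_self [simp]: "log_mean a a = a"
  by (simp add: log_mean_def)

lemma log_mean_commute: "log_mean a b = log_mean b a"
  by (simp add: log_mean_def) (metis minus_diff_eq minus_divide_divide)

lemma log_mean_mult_ln_diff:
  assumes "a > 0" "b > 0"
  shows "log_mean a b * (ln b - ln a) = b - a"
  using assms by (simp add: log_mean_def)

lemma log_mean_nonzero:
  assumes "a > 0" "b > 0"
  shows "log_mean a b \<noteq> 0"
  using assms by (simp add: log_mean_def)


section \<open>States and entropy variables in terms of velocity and temperature\<close>

lemma momentum_eq:
  assumes "U \<in> states P"
  shows "U $ 3 = (U $ 1 + U $ 2) * velocity U $ 1"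
    "U $ 4 = (U $ 1 + U $ 2) * velocity U $ 2"
    "U $ 5 = (U $ 1 + U $ 2) * velocity U $ 3"
proof -
  have "U $ 1 + U $ 2 \<noteq> 0"
    using assms by (simp add: states_def)
  then show "U $ 3 = (U $ 1 + U $ 2) * velocity U $ 1"
    "U $ 4 = (U $ 1 + U $ 2) * velocity U $ 2"
    "U $ 5 = (U $ 1 + U $ 2) * velocity U $ 3"
    by (simp_all add: velocity_def total_density_def sum_2)
qed

lemma norm_sq_3: "(norm (x :: real^3))\<^sup>2 = (x $ 1)\<^sup>2 + (x $ 2)\<^sup>2 + (x $ 3)\<^sup>2"
  unfolding power2_norm_eq_inner by (simp add: inner_vec_def sum_3 power2_eq_square)

lemma energy_eq:
  assumes "\<And>l. cv P l > 0" "U \<in> states P"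
  shows "U $ 6 = (cv P 1 * U $ 1 + cv P 2 * U $ 2) * temperature P U
    + (U $ 1 + U $ 2) * (norm (velocity U))\<^sup>2 / 2 + pinf P 1 + pinf P 2"
proof -
  have "U $ 1 > 0" "U $ 2 > 0"
    using assms(2) by (auto simp: states_def)
  then have "internal_energy U = (\<Sum>l\<in>UNIV. cv P l * U $ sp l * temperature P U + pinf P l)"
    using temperature_eq_iff[OF assms(1)] by blast
  then show ?thesis
    by (simp add: internal_energy_def total_density_def sum_2 algebra_simps)
qed

lemma entropy_potential_eq:
  assumes "\<And>l. cv P l > 0" "U \<in> states P"
  shows "entropy_potential P U =
    (\<Sum>l\<in>UNIV. gas_const P l * U $ sp l - pinf P l / temperature P U)"
proof -
  have T: "temperature P U \<noteq> 0"
    using assms(2) by (simp add: states_def)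
  show ?thesis
    using T
    by (simp add: entropy_potential_def entropy_vars_explicit[OF assms] inner_vec_def sum_6 sum_2
        entropy_def momentum_eq[OF assms(2)] energy_eq[OF assms] norm_sq_3 gas_const_def)
      (simp add: field_simps power2_eq_square)
qed

text \<open>Along a coordinate direction the flux is \<open>v\<^sub>k U\<close> plus the pressure acting on momentum and
  energy. The pressure terms cancel against each other in the pairing with the entropy variables,
  as the latter contain \<open>v\<^sub>k / T\<close> and \<open>- 1 / T\<close>.\<close>

lemma entropy_potential_flux_eq:
  assumes "\<And>l. cv P l > 0" "U \<in> states P"
  shows "entropy_potential_flux P k U = entropy_potential P U * velocity U $ k"
proof -
  define p where "p = pressure P U *\<^sub>R
    (vector [0, 0, axis k 1 $ 1, axis k 1 $ 2, axis k 1 $ 3, velocity U $ k] :: real^6)"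
  have flux: "flux P k U = velocity U $ k *\<^sub>R U + p"
    by (simp add: vec_eq_iff forall_6 flux_def Let_def p_def total_density_def sum_2
        momentum_eq[OF assms(2)] algebra_simps)
  have "k = 1 \<or> k = 2 \<or> k = 3"
    using exhaust_3 by blast
  then have "entropy_vars P U \<bullet> p = 0"
    by (auto simp: p_def entropy_vars_explicit[OF assms] inner_vec_def sum_6 axis_def)
  then show ?thesis
    by (simp add: entropy_potential_flux_def entropy_potential_def entropy_flux_def flux
        inner_add_right algebra_simps)
qed


section \<open>Jumps of the entropy variables\<close>

text \<open>The common mechanism behind both jump identities: \<open>m\<close> and \<open>\<pi>\<close> are left free so that the
  density and the flux are two instances. Since \<open>- z\<^sub>6\<close> is the last entropy variable, the energy
  component can absorb the three unwanted multiples of the jump of \<open>z\<^sub>6\<close>, which arise from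
  \<open>c\<^sub>l ln z\<^sub>6\<close>, from \<open>z\<^sub>6 |v|\<^sup>2 / 2\<close> and from \<open>z\<^sub>6 v\<close>.\<close>

lemma entropy_vars_jump_inner:
  fixes P :: material and Ul Ur :: state and w1 w2 m3 m4 m5 \<pi> :: real
  assumes cv: "\<And>l. cv P l > 0" and Ul: "Ul \<in> states P" and Ur: "Ur \<in> states P"
  defines "vl \<equiv> velocity Ul" and "vr \<equiv> velocity Ur"
    and "bl \<equiv> 1 / temperature P Ul" and "br \<equiv> 1 / temperature P Ur"
  defines "q \<equiv> mean ((vl $ 1)\<^sup>2) ((vr $ 1)\<^sup>2) + mean ((vl $ 2)\<^sup>2) ((vr $ 2)\<^sup>2)
      + mean ((vl $ 3)\<^sup>2) ((vr $ 3)\<^sup>2)"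
    and "a1 \<equiv> mean (vl $ 1) (vr $ 1)" and "a2 \<equiv> mean (vl $ 2) (vr $ 2)"
    and "a3 \<equiv> mean (vl $ 3) (vr $ 3)"
  shows "(entropy_vars P Ur - entropy_vars P Ul) \<bullet> vector
      [w1, w2, m3, m4, m5,
       w1 * (cv P 1 / log_mean bl br - q / 2) + w2 * (cv P 2 / log_mean bl br - q / 2)
         + (a1 * m3 + a2 * m4 + a3 * m5) + \<pi>]
    = gas_const P 1 * w1 * (ln (Ur $ 1) - ln (Ul $ 1))
      + gas_const P 2 * w2 * (ln (Ur $ 2) - ln (Ul $ 2))
      + mean bl br * ((vr $ 1 - vl $ 1) * (m3 - (w1 + w2) * a1)
          + (vr $ 2 - vl $ 2) * (m4 - (w1 + w2) * a2)
          + (vr $ 3 - vl $ 3) * (m5 - (w1 + w2) * a3))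
      - \<pi> * (br - bl)"
proof -
  have b: "bl > 0" "br > 0"
    using Ul Ur by (auto simp: states_def bl_def br_def)
  \<comment> \<open>Naming the reciprocal keeps the remaining identity polynomial.\<close>
  define M where "M = 1 / log_mean bl br"
  have M: "c / log_mean bl br = c * M" for c
    by (simp add: M_def)
  have "log_mean bl br * (ln br - ln bl) = br - bl" "log_mean bl br \<noteq> 0"
    using b by (auto intro: log_mean_mult_ln_diff log_mean_nonzero[THEN notE])
  then have lnb: "ln br = ln bl + M * (br - bl)"
    by (simp add: M_def field_simps)
  have V: "entropy_vars P U = vector
      [cv P 1 * ln \<beta> + gas_const P 1 * ln (U $ 1)
         - \<beta> * ((u $ 1)\<^sup>2 + (u $ 2)\<^sup>2 + (u $ 3)\<^sup>2) / 2 + cv P 1 * Gam P 1,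
       cv P 2 * ln \<beta> + gas_const P 2 * ln (U $ 2)
         - \<beta> * ((u $ 1)\<^sup>2 + (u $ 2)\<^sup>2 + (u $ 3)\<^sup>2) / 2 + cv P 2 * Gam P 2,
       \<beta> * u $ 1, \<beta> * u $ 2, \<beta> * u $ 3, - \<beta>]"
    if "U \<in> states P" "\<beta> = 1 / temperature P U" "u = velocity U" for U \<beta> u
    using that(1) unfolding that(2,3)
    by (simp add: entropy_vars_explicit[OF cv that(1)] vec_eq_iff forall_6 species_entropy_def
        norm_sq_3 states_def ln_div)
  show ?thesis
    unfolding V[OF Ul bl_def[THEN meta_eq_to_obj_eq] vl_def[THEN meta_eq_to_obj_eq]]
      V[OF Ur br_def[THEN meta_eq_to_obj_eq] vr_def[THEN meta_eq_to_obj_eq]] lnb M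
    by (simp add: inner_vec_def sum_6 q_def a1_def a2_def a3_def mean_def)
      (simp add: field_simps power2_eq_square)
qed


section \<open>Symmetry, consistency and entropy conservation\<close>

lemma U_tilde_commute: "U_tilde P Ul Ur = U_tilde P Ur Ul"
  unfolding U_tilde_def Let_def by (simp add: mean_commute log_mean_commute)

lemma F1_tilde_commute: "F1_tilde P Ul Ur = F1_tilde P Ur Ul"
  unfolding F1_tilde_def Let_def by (simp add: mean_commute log_mean_commute)

lemma U_tilde_self:
  assumes "\<And>l. cv P l > 0" "U \<in> states P"
  shows "U_tilde P U U = U"
  by (simp add: vec_eq_iff forall_6 U_tilde_def Let_def z_vars_def sum_2
      momentum_eq[OF assms(2)] energy_eq[OF assms] norm_sq_3)
    (simp add: field_simps power2_eq_square)

lemma F1_tilde_self: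
  assumes "\<And>l. cv P l > 0" "U \<in> states P"
  shows "F1_tilde P U U = flux P 1 U"
  by (simp add: vec_eq_iff forall_6 F1_tilde_def flux_def Let_def z_vars_def sum_2 axis_def
      total_density_def pressure_def energy_eq[OF assms] norm_sq_3)
    (simp add: field_simps power2_eq_square)

text \<open>The momentum components are \<open>(w\<^sub>1 + w\<^sub>2){v}\<close>, so the velocity jumps drop out; the logarithmic
  means then turn the jumps of \<open>ln z\<^sub>l\<close> into jumps of densities, in which the potential is linear.\<close>

lemma U_tilde_jump:
  assumes cv: "\<And>l. cv P l > 0" and Ul: "Ul \<in> states P" and Ur: "Ur \<in> states P"
  shows "(entropy_vars P Ur - entropy_vars P Ul) \<bullet> U_tilde P Ul Ur
    = entropy_potential P Ur - entropy_potential P Ul"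
proof -
  define vl where "vl = velocity Ul"
  define vr where "vr = velocity Ur"
  define bl where "bl = 1 / temperature P Ul"
  define br where "br = 1 / temperature P Ur"
  define w1 where "w1 = log_mean (Ul $ 1) (Ur $ 1)"
  define w2 where "w2 = log_mean (Ul $ 2) (Ur $ 2)"
  define a1 where "a1 = mean (vl $ 1) (vr $ 1)"
  define a2 where "a2 = mean (vl $ 2) (vr $ 2)"
  define a3 where "a3 = mean (vl $ 3) (vr $ 3)"
  define q where "q = mean ((vl $ 1)\<^sup>2) ((vr $ 1)\<^sup>2) + mean ((vl $ 2)\<^sup>2) ((vr $ 2)\<^sup>2)
      + mean ((vl $ 3)\<^sup>2) ((vr $ 3)\<^sup>2)"
  note defs = vl_def vr_def bl_def br_def a1_def a2_def a3_def q_def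
  have ln: "w1 * (ln (Ur $ 1) - ln (Ul $ 1)) = Ur $ 1 - Ul $ 1"
    "w2 * (ln (Ur $ 2) - ln (Ul $ 2)) = Ur $ 2 - Ul $ 2"
    using Ul Ur by (simp_all add: states_def w1_def w2_def log_mean_mult_ln_diff)
  have "U_tilde P Ul Ur = vector
      [w1, w2, a1 * (w1 + w2), a2 * (w1 + w2), a3 * (w1 + w2),
       w1 * (cv P 1 / log_mean bl br - q / 2) + w2 * (cv P 2 / log_mean bl br - q / 2)
         + (a1 * (a1 * (w1 + w2)) + a2 * (a2 * (w1 + w2)) + a3 * (a3 * (w1 + w2)))
         + (pinf P 1 + pinf P 2)]"
    by (simp add: vec_eq_iff forall_6 U_tilde_def Let_def z_vars_def sum_2 w1_def w2_def defs)
      (simp add: algebra_simps power2_eq_square)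
  then have "(entropy_vars P Ur - entropy_vars P Ul) \<bullet> U_tilde P Ul Ur
    = gas_const P 1 * (w1 * (ln (Ur $ 1) - ln (Ul $ 1)))
      + gas_const P 2 * (w2 * (ln (Ur $ 2) - ln (Ul $ 2))) - (pinf P 1 + pinf P 2) * (br - bl)"
    using entropy_vars_jump_inner[OF cv Ul Ur, of w1 w2 "a1 * (w1 + w2)" "a2 * (w1 + w2)"
        "a3 * (w1 + w2)" "pinf P 1 + pinf P 2", folded vl_def vr_def bl_def br_def, folded a1_def a2_def a3_def q_def]
    by (simp add: mult.commute mult.left_commute)
  also have "\<dots> = entropy_potential P Ur - entropy_potential P Ul"
    unfolding ln
    by (simp add: entropy_potential_eq[OF cv Ul] entropy_potential_eq[OF cv Ur] sum_2 bl_def br_def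
        algebra_simps)
  finally show ?thesis .
qed

text \<open>Here the first velocity jump survives, weighted with the pressure average. Its form
  \<open>\<Sum>\<^sub>l R\<^sub>l {z\<^sub>l} / {z\<^sub>6}\<close>, rather than some other mean of \<open>\<rho>\<^sub>l T\<close>, is what cancels the factor \<open>{z\<^sub>6}\<close>
  and completes the Leibniz rule for the potential times \<open>v\<^sub>1\<close>.\<close>

lemma F1_tilde_jump:
  assumes cv: "\<And>l. cv P l > 0" and Ul: "Ul \<in> states P" and Ur: "Ur \<in> states P"
  shows "(entropy_vars P Ur - entropy_vars P Ul) \<bullet> F1_tilde P Ul Ur
    = entropy_potential_flux P 1 Ur - entropy_potential_flux P 1 Ul"
proof -
  define vl where "vl = velocity Ul"
  define vr where "vr = velocity Ur"
  define bl where "bl = 1 / temperature P Ul"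
  define br where "br = 1 / temperature P Ur"
  define w1 where "w1 = log_mean (Ul $ 1) (Ur $ 1)"
  define w2 where "w2 = log_mean (Ul $ 2) (Ur $ 2)"
  define a1 where "a1 = mean (vl $ 1) (vr $ 1)"
  define a2 where "a2 = mean (vl $ 2) (vr $ 2)"
  define a3 where "a3 = mean (vl $ 3) (vr $ 3)"
  define q where "q = mean ((vl $ 1)\<^sup>2) ((vr $ 1)\<^sup>2) + mean ((vl $ 2)\<^sup>2) ((vr $ 2)\<^sup>2)
      + mean ((vl $ 3)\<^sup>2) ((vr $ 3)\<^sup>2)"
  define s where "s = gas_const P 1 * mean (Ul $ 1) (Ur $ 1) + gas_const P 2 * mean (Ul $ 2) (Ur $ 2)"
  define p where "p = pinf P 1 + pinf P 2"
  define f where "f = w1 * a1 + w2 * a1"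
  define m3 where "m3 = a1 * f + s / mean bl br - p"
  note defs = vl_def vr_def bl_def br_def a1_def a2_def a3_def q_def
  have ln: "w1 * (ln (Ur $ 1) - ln (Ul $ 1)) = Ur $ 1 - Ul $ 1"
    "w2 * (ln (Ur $ 2) - ln (Ul $ 2)) = Ur $ 2 - Ul $ 2"
    using Ul Ur by (simp_all add: states_def w1_def w2_def log_mean_mult_ln_diff)
  have "bl > 0" "br > 0"
    using Ul Ur by (simp_all add: states_def bl_def br_def)
  then have "mean bl br \<noteq> 0"
    by (simp add: mean_def)
  then have defect: "mean bl br * (m3 - f * a1) = s - p * mean bl br"
    by (simp add: m3_def algebra_simps)
  have "F1_tilde P Ul Ur = vector
      [w1 * a1, w2 * a1, m3, a2 * f, a3 * f,
       w1 * a1 * (cv P 1 / log_mean bl br - q / 2) + w2 * a1 * (cv P 2 / log_mean bl br - q / 2)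
         + (a1 * m3 + a2 * (a2 * f) + a3 * (a3 * f)) + a1 * p]"
    by (simp add: vec_eq_iff forall_6 F1_tilde_def Let_def z_vars_def sum_2 w1_def w2_def f_def
        m3_def s_def p_def defs add.assoc)
  then have "(entropy_vars P Ur - entropy_vars P Ul) \<bullet> F1_tilde P Ul Ur
    = gas_const P 1 * a1 * (w1 * (ln (Ur $ 1) - ln (Ul $ 1)))
      + gas_const P 2 * a1 * (w2 * (ln (Ur $ 2) - ln (Ul $ 2)))
      + (vr $ 1 - vl $ 1) * (mean bl br * (m3 - f * a1)) - a1 * p * (br - bl)"
    using entropy_vars_jump_inner[OF cv Ul Ur, of "w1 * a1" "w2 * a1" m3 "a2 * f" "a3 * f" "a1 * p",
        folded vl_def vr_def bl_def br_def, folded a1_def a2_def a3_def q_def f_def]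
    by (simp add: mult.commute mult.left_commute)
  also have "\<dots> = (gas_const P 1 * Ur $ 1 + gas_const P 2 * Ur $ 2 - p * br) * vr $ 1
      - (gas_const P 1 * Ul $ 1 + gas_const P 2 * Ul $ 2 - p * bl) * vl $ 1"
    unfolding ln defect unfolding s_def a1_def mean_def by (simp add: field_simps)
  also have "\<dots> = entropy_potential_flux P 1 Ur - entropy_potential_flux P 1 Ul"
    by (simp add: entropy_potential_flux_eq[OF cv Ul] entropy_potential_flux_eq[OF cv Ur]
        entropy_potential_eq[OF cv Ul] entropy_potential_eq[OF cv Ur] sum_2 defs p_def
        diff_divide_distrib add_divide_distrib algebra_simps)
  finally show ?thesis .
qed

theorem mainTheorem2:
  fixes P :: material
  assumes cv_pos: "\<And>l. cv P l > 0"
  shows "(\<forall>Ul\<in>states P. \<forall>Ur\<in>states P.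
            U_tilde P Ul Ur = U_tilde P Ur Ul \<and>
            F1_tilde P Ul Ur = F1_tilde P Ur Ul) \<and>
         (\<forall>U\<in>states P. U_tilde P U U = U \<and> F1_tilde P U U = flux P 1 U) \<and>
         (\<forall>Ul\<in>states P. \<forall>Ur\<in>states P.
            (entropy_vars P Ur - entropy_vars P Ul) \<bullet> U_tilde P Ul Ur
              = entropy_potential P Ur - entropy_potential P Ul \<and>
            (entropy_vars P Ur - entropy_vars P Ul) \<bullet> F1_tilde P Ul Ur
              = entropy_potential_flux P 1 Ur - entropy_potential_flux P 1 Ul)"
  using U_tilde_commute F1_tilde_commute U_tilde_self[OF cv_pos] F1_tilde_self[OF cv_pos]
    U_tilde_jump[OF cv_pos] F1_tilde_jump[OF cv_pos]
  by blast

end
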